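(* We have $112\approx122$ and $221\approx211$ as subwords on $\mathcal{F}_n$ for all $n\geq 1$. That is, for all $n\geq 1$ and all $k\geq 0$, the number of $\pi\in\mathcal{F}_n$ with $\#112(\pi)=k$ equals the number of $\pi\in\mathcal{F}_n$ with $\#122(\pi)=k$, and the number of $\pi\in\mathcal{F}_n$ with $\#221(\pi)=k$ equals the number of $\pi\in\mathcal{F}_n$ with $\#211(\pi)=k$.
   Context: A Catalan word of length $n\geq 1$ is an integer sequence $\pi=\pi_1\cdots\pi_n$ with $\pi_1=1$ and $1\leq \pi_{i+1}\leq \pi_i+1$ for $1\leq i\leq n-1$. A (weakly) increasing run of a word is a maximal nondecreasing string of consecutive letters. A Catalan word is flattened if the sequence of first letters of its increasing runs, read from left to right, is nondecreasing. $\mathcal{F}_n$ is the set of flattened Catalan words of length $n$. For a pattern $\tau=\tau_1\cdots\tau_m$, $\#\tau(\pi)$ is the number of occurrences of $\tau$ in $\pi$ as a consecutive (subword) pattern, i.e., the number of indices $i$ such that $\pi_i\pi_{i+1}\cdots\pi_{i+m-1}$ is order-isomorphic to $\tau$. The notation $\sigma\approx\tau$ means that the statistics $\#\sigma$ and $\#\tau$ are identically distributed on $\mathcal{F}_n$. *)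

theory Defs
  imports Main
begin

(* Words are lists of letters; the letter pi_i of the usual 1-based notation is w ! (i - 1). *)

definition catalan_word :: "nat list \<Rightarrow> bool" where
  "catalan_word w \<longleftrightarrow>
     w \<noteq> [] \<and> w ! 0 = 1 \<and>
     (\<forall>i. i + 1 < length w \<longrightarrow> 1 \<le> w ! (i + 1) \<and> w ! (i + 1) \<le> w ! i + 1)"

(* The consecutive letters w ! i, ..., w ! (j - 1). *)

definition factor :: "'a list \<Rightarrow> nat \<Rightarrow> nat \<Rightarrow> 'a list" where
  "factor w i j = take (j - i) (drop i w)"

definition nondec_factor :: "nat list \<Rightarrow> nat \<Rightarrow> nat \<Rightarrow> bool" where
  "nondec_factor w i j \<longleftrightarrow> i < j \<and> j \<le> length w \<and> sorted (factor w i j)"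

definition increasing_run :: "nat list \<Rightarrow> nat \<Rightarrow> nat \<Rightarrow> bool" where
  "increasing_run w i j \<longleftrightarrow>
     nondec_factor w i j \<and>
     (\<forall>i' j'. i' \<le> i \<and> j \<le> j' \<and> nondec_factor w i' j' \<longrightarrow> i' = i \<and> j' = j)"

definition run_starts :: "nat list \<Rightarrow> nat set" where
  "run_starts w = {i. \<exists>j. increasing_run w i j}"

definition flattened :: "nat list \<Rightarrow> bool" where
  "flattened w \<longleftrightarrow> mono_on (run_starts w) (\<lambda>i. w ! i)"

definition flattened_catalan_words :: "nat \<Rightarrow> nat list set" where
  "flattened_catalan_words n = {w. catalan_word w \<and> length w = n \<and> flattened w}"

(* Using the equivalence for both (i, j) and (j, i), equal letters correspond to equal letters. *)

definition order_isomorphic :: "nat list \<Rightarrow> nat list \<Rightarrow> bool" where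
  "order_isomorphic u v \<longleftrightarrow>
     length u = length v \<and>
     (\<forall>i < length u. \<forall>j < length u. u ! i < u ! j \<longleftrightarrow> v ! i < v ! j)"

definition subword_occurrences :: "nat list \<Rightarrow> nat list \<Rightarrow> nat" where
  "subword_occurrences \<tau> w =
     card {i. i + length \<tau> \<le> length w \<and> order_isomorphic (factor w i (i + length \<tau>)) \<tau>}"

definition equidistributed :: "nat \<Rightarrow> nat list \<Rightarrow> nat list \<Rightarrow> bool" where
  "equidistributed n \<sigma> \<tau> \<longleftrightarrow>
     (\<forall>k. card {w \<in> flattened_catalan_words n. subword_occurrences \<sigma> w = k} =
          card {w \<in> flattened_catalan_words n. subword_occurrences \<tau> w = k})"

(* Finiteness matters here because card is 0 on infinite sets. *)

lemma catalan_word_nth_le: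
  assumes "catalan_word w" "i < length w"
  shows "w ! i \<le> i + 1"
  using assms(2)
proof (induction i)
  case 0
  then show ?case using assms(1) by (simp add: catalan_word_def)
next
  case (Suc i)
  from assms(1) have "\<forall>i. i + 1 < length w \<longrightarrow> w ! (i + 1) \<le> w ! i + 1"
    unfolding catalan_word_def by blast
  from this[rule_format, of i] Suc.prems have "w ! Suc i \<le> w ! i + 1"
    by (metis Suc_eq_plus1)
  moreover have "w ! i \<le> i + 1"
    by (rule Suc.IH) (rule Suc_lessD[OF Suc.prems])
  ultimately show ?case by linarith
qed

lemma finite_flattened_catalan_words: "finite (flattened_catalan_words n)"
proof (rule finite_subset)
  show "flattened_catalan_words n \<subseteq> {w. set w \<subseteq> {..n} \<and> length w = n}"
  proof
    fix w assume "w \<in> flattened_catalan_words n"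
    then have w: "catalan_word w" "length w = n"
      by (simp_all add: flattened_catalan_words_def)
    have "x \<le> n" if x: "x \<in> set w" for x
    proof -
      obtain i where "i < length w" "x = w ! i" using x by (auto simp: in_set_conv_nth)
      with catalan_word_nth_le[OF w(1), of i] w(2) show ?thesis by simp
    qed
    with w(2) show "w \<in> {w. set w \<subseteq> {..n} \<and> length w = n}" by auto
  qed
  show "finite {w. set w \<subseteq> {..n} \<and> length w = n}"
    by (rule finite_lists_length_eq) simp
qed

end

theory Submission
  imports Defs "HOL-Combinatorics.Permutations"
begin

text \<open>
  A word is determined by its skeleton, obtained by contracting each block of equal consecutive
  letters to one letter, together with the list of the block lengths. Two observations reduce the
  theorem to a statement about block lengths alone.

  First, whether a word is a flattened Catalan word depends only on its skeleton: repeating a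
  letter respects the Catalan condition, and it leaves the sequence of first letters of the runs
  unchanged (lemmas \<open>catalan_word_remdups_adj\<close> and \<open>flattened_remdups_adj\<close>).

  Second, let \<open>v\<close> be the skeleton, let \<open>m\<close> list the block lengths, and let \<open>I\<close> be the set of positions
  \<open>j\<close> at which \<open>v\<close> ascends from \<open>v\<^sub>j\<close> to the next letter. An occurrence of 112 is an ascent out of a
  block of length at least 2, and an occurrence of 122 is an ascent into such a block. So the two
  statistics count the blocks of length at least 2 with index in \<open>I\<close> and in \<open>I + 1\<close>, respectively
  (lemmas \<open>occurrences_level_then_step\<close> and \<open>occurrences_step_then_level\<close>). As \<open>I\<close> and \<open>I + 1\<close> have
  equally many elements, some permutation of all block indices carries one onto the other.
  Rearranging the block lengths by it preserves the skeleton and the length of the word and turns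
  one statistic into the other. For 221 and 211 take \<open>I\<close> to be the set of descents instead.

  The argument shows that the equidistribution holds on any finite set of words of fixed length
  whose membership depends only on the skeleton.
\<close>

section \<open>Words as skeletons with block lengths\<close>

definition expand :: "'a list \<Rightarrow> nat list \<Rightarrow> 'a list" where
  "expand v ms = concat (map2 replicate ms v)"

lemma expand_Nil [simp]: "expand [] ms = []"
  by (simp add: expand_def)

lemma expand_Cons [simp]: "expand (x # v) (m # ms) = replicate m x @ expand v ms"
  by (simp add: expand_def)

lemma length_expand: "length ms = length v \<Longrightarrow> length (expand v ms) = sum_list ms"
  by (induction ms v rule: list_induct2) auto

lemma expand_eq_Nil_iff:
  "length ms = length v \<Longrightarrow> 0 \<notin> set ms \<Longrightarrow> expand v ms = [] \<longleftrightarrow> v = []"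
  by (induction ms v rule: list_induct2) auto

lemma hd_expand:
  "length ms = length v \<Longrightarrow> 0 \<notin> set ms \<Longrightarrow> v \<noteq> [] \<Longrightarrow> hd (expand v ms) = hd v"
  by (induction ms v rule: list_induct2) (auto simp: hd_append)

lemma remdups_adj_expand:
  assumes "length ms = length v" "0 \<notin> set ms" "distinct_adj v"
  shows "remdups_adj (expand v ms) = v"
  using assms
proof (induction ms v rule: list_induct2)
  case (Cons m ms x v)
  then have "expand v ms = [] \<or> x \<noteq> hd (expand v ms)"
    by (auto simp: hd_expand expand_eq_Nil_iff distinct_adj_Cons)
  then show ?case
    using Cons by (subst expand_Cons, subst remdups_adj_append')
      (auto simp: remdups_adj_replicate distinct_adj_Cons)
qed simp

text \<open>Without \<open>distinct_adj v\<close>, lengths could be shifted between adjacent blocks of one letter.\<close>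

lemma inj_on_expand: "inj_on (expand v) {ms. length ms = length v \<and> 0 \<notin> set ms \<and> distinct_adj v}"
proof -
  have "ms = ms'"
    if "length ms = length v" "length ms' = length v" "0 \<notin> set ms" "0 \<notin> set ms'"
       "distinct_adj v" "expand v ms = expand v ms'" for ms ms'
    using that
  proof (induction ms v arbitrary: ms' rule: list_induct2)
    case (Cons m ms x v)
    from Cons.prems obtain m' ns where ms': "ms' = m' # ns" by (cases ms') auto
    \<comment> \<open>The first block length is recovered as the number of leading letters \<open>x\<close>, because the
      next block starts with a different letter.\<close>
    have lead: "takeWhile (\<lambda>y. y = x) (replicate k x @ expand v ks) = replicate k x"
      if "length ks = length v" "0 \<notin> set ks" for k ks
    proof (cases "v = []")
      case False
      then have "hd (expand v ks) \<noteq> x" "expand v ks \<noteq> []"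
        using that Cons.prems by (auto simp: hd_expand expand_eq_Nil_iff distinct_adj_Cons)
      then show ?thesis
        by (cases "expand v ks") (auto simp: takeWhile_append)
    qed (auto simp: takeWhile_append)
    have "replicate m x = replicate m' x"
      using lead[of ms m] lead[of ns m'] Cons.prems Cons.hyps ms' by auto
    then have "m = m'" by (metis length_replicate)
    then show ?case using Cons ms' by (auto simp: distinct_adj_Cons)
  qed simp
  then show ?thesis by (auto simp: inj_on_def)
qed

lemma ex_expand:
  "\<exists>ms. length ms = length (remdups_adj w) \<and> 0 \<notin> set ms \<and> expand (remdups_adj w) ms = w"
proof (induction w rule: remdups_adj.induct)
  case (2 x)
  show ?case by (intro exI[of _ "[1]"]) simp
next
  case (3 x y w)
  show ?case
  proof (cases "x = y")
    case True
    with 3(1) obtain ms where ms: "length ms = length (remdups_adj (x # w))" "0 \<notin> set ms"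
      "expand (remdups_adj (x # w)) ms = x # w" by auto
    obtain v where v: "remdups_adj (x # w) = x # v"
      by (metis remdups_adj_Cons_alt)
    obtain m ns where "ms = m # ns" using ms v by (cases ms) auto
    then show ?thesis using ms v True by (intro exI[of _ "Suc m # ns"]) auto
  next
    case False
    with 3(2) obtain ms where "length ms = length (remdups_adj (y # w))" "0 \<notin> set ms"
      "expand (remdups_adj (y # w)) ms = y # w" by auto
    then show ?thesis using False by (intro exI[of _ "1 # ms"]) auto
  qed
qed simp

lemma bij_betw_expand:
  assumes "distinct_adj v"
  shows "bij_betw (expand v)
    {ms. length ms = length v \<and> 0 \<notin> set ms \<and> sum_list ms = n \<and> P (expand v ms)}
    {w. remdups_adj w = v \<and> length w = n \<and> P w}"
proof (rule bij_betw_imageI)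
  show "inj_on (expand v)
      {ms. length ms = length v \<and> 0 \<notin> set ms \<and> sum_list ms = n \<and> P (expand v ms)}"
    by (rule inj_on_subset[OF inj_on_expand]) (use assms in auto)
next
  show "expand v ` {ms. length ms = length v \<and> 0 \<notin> set ms \<and> sum_list ms = n \<and> P (expand v ms)} =
      {w. remdups_adj w = v \<and> length w = n \<and> P w}" (is "?A = ?B")
  proof
    show "?A \<subseteq> ?B" using assms by (auto simp: remdups_adj_expand length_expand)
    show "?B \<subseteq> ?A"
    proof
      fix w assume w: "w \<in> ?B"
      with ex_expand[of w] obtain ms where
        "length ms = length v" "0 \<notin> set ms" "expand v ms = w" by auto
      with w show "w \<in> ?A" by (auto simp: length_expand intro!: image_eqI[of _ _ ms])
    qed
  qed
qed

section \<open>Pattern occurrences in terms of block lengths\<close>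

lemma card_less_Suc_shift:
  "card {i. i < Suc n \<and> Q i} = of_bool (Q 0) + card {i. i < n \<and> Q (Suc i)}"
proof -
  have eq: "{i. i < Suc n \<and> Q i} = (if Q 0 then {0} else {}) \<union> Suc ` {i. i < n \<and> Q (Suc i)}"
    by (auto simp: image_iff less_Suc_eq_0_disj)
  show ?thesis unfolding eq
    by (subst card_Un_disjoint) (auto simp: card_image)
qed

lemma subword_occurrences_short:
  "length w < length \<tau> \<Longrightarrow> subword_occurrences \<tau> w = 0"
  by (simp add: subword_occurrences_def)

lemma subword_occurrences_Cons:
  assumes "length \<tau> \<le> Suc (length w)"
  shows "subword_occurrences \<tau> (x # w) =
    of_bool (order_isomorphic (take (length \<tau>) (x # w)) \<tau>) + subword_occurrences \<tau> w"
proof -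
  let ?k = "length \<tau>" and ?n = "Suc (length w) - length \<tau>"
  let ?Q = "\<lambda>i. order_isomorphic (factor (x # w) i (i + ?k)) \<tau>"
  have "{i. i + ?k \<le> length (x # w) \<and> ?Q i} = {i. i < Suc ?n \<and> ?Q i}"
    using assms by auto
  moreover have "{i. i < ?n \<and> ?Q (Suc i)} =
      {i. i + ?k \<le> length w \<and> order_isomorphic (factor w i (i + ?k)) \<tau>}"
    by (auto simp: factor_def)
  ultimately show ?thesis
    unfolding subword_occurrences_def by (simp add: card_less_Suc_shift) (simp add: factor_def)
qed

lemma subword_occurrences_Cons3:
  assumes "length \<tau> = 3"
  shows "subword_occurrences \<tau> (x # y # z # w) =
    of_bool (order_isomorphic [x, y, z] \<tau>) + subword_occurrences \<tau> (y # z # w)"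
  using subword_occurrences_Cons[of \<tau> "y # z # w" x] assms by (simp add: numeral_3_eq_3)

lemma order_isomorphic_length3:
  "order_isomorphic [a, b, c] [a', b', c'] \<longleftrightarrow>
    (a < b \<longleftrightarrow> a' < b') \<and> (a < c \<longleftrightarrow> a' < c') \<and> (b < a \<longleftrightarrow> b' < a') \<and>
    (b < c \<longleftrightarrow> b' < c') \<and> (c < a \<longleftrightarrow> c' < a') \<and> (c < b \<longleftrightarrow> c' < b')"
  by (auto simp: order_isomorphic_def All_less_Suc)

text \<open>
  The relation \<open>R\<close> stands for \<open><\<close> or \<open>>\<close>, so that a single count covers both pairs of patterns.
\<close>

lemma level_then_step_prepend_block:
  assumes \<tau>: "length \<tau> = 3" "\<And>a b c. order_isomorphic [a, b, c] \<tau> \<longleftrightarrow> a = b \<and> R b c"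
    and "\<not> R x x" and "w = [] \<or> hd w \<noteq> x"
  shows "subword_occurrences \<tau> (replicate (Suc m) x @ w) =
    of_bool (m \<ge> 1 \<and> w \<noteq> [] \<and> R x (hd w)) + subword_occurrences \<tau> w"
proof (induction m)
  case 0
  show ?case
  proof (cases w)
    case (Cons y u)
    then show ?thesis using assms
      by (cases u) (auto simp: subword_occurrences_Cons3 subword_occurrences_short)
  qed (simp add: \<tau> subword_occurrences_short)
next
  case (Suc m)
  show ?case
  proof (cases m)
    case 0
    with Suc show ?thesis using assms
      by (cases w) (auto simp: subword_occurrences_Cons3 subword_occurrences_short)
  next
    case (Suc k)
    with Suc.IH show ?thesis using assms by (simp add: subword_occurrences_Cons3)
  qed
qed

lemma step_then_level_prepend_block:
  assumes \<tau>: "length \<tau> = 3" "\<And>a b c. order_isomorphic [a, b, c] \<tau> \<longleftrightarrow> R a b \<and> b = c"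
    and "\<not> R x x"
  shows "subword_occurrences \<tau> (replicate (Suc m) x @ w) =
    of_bool (2 \<le> length w \<and> R x (hd w) \<and> w ! 0 = w ! 1) + subword_occurrences \<tau> w"
proof (induction m)
  case 0
  show ?case
  proof (cases w)
    case (Cons y u)
    then show ?thesis using assms
      by (cases u) (auto simp: subword_occurrences_Cons3 subword_occurrences_short)
  qed (simp add: \<tau> subword_occurrences_short)
next
  case (Suc m)
  show ?case
  proof (cases m)
    case 0
    with Suc show ?thesis using assms
      by (cases w) (auto simp: subword_occurrences_Cons3 subword_occurrences_short)
  next
    case (Suc k)
    with Suc.IH show ?thesis using assms by (simp add: subword_occurrences_Cons3)
  qed
qed

lemma occurrences_level_then_step:
  assumes \<tau>: "length \<tau> = 3" "\<And>a b c. order_isomorphic [a, b, c] \<tau> \<longleftrightarrow> a = b \<and> R b c"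
    and R: "\<And>x. \<not> R x x"
    and "length ms = length v" "0 \<notin> set ms" "distinct_adj v"
  shows "subword_occurrences \<tau> (expand v ms) =
    card {j. Suc j < length v \<and> R (v ! j) (v ! Suc j) \<and> 2 \<le> ms ! j}"
  using assms(4-)
proof (induction ms v rule: list_induct2)
  case Nil
  show ?case using \<tau>(1) by (simp add: subword_occurrences_short)
next
  case (Cons m ms x v)
  obtain k where k: "m = Suc k" using Cons.prems by (cases m) auto
  have w: "expand v ms = [] \<or> hd (expand v ms) \<noteq> x"
    using Cons by (auto simp: hd_expand expand_eq_Nil_iff distinct_adj_Cons)
  have IH: "subword_occurrences \<tau> (expand v ms) =
      card {j. Suc j < length v \<and> R (v ! j) (v ! Suc j) \<and> 2 \<le> ms ! j}"
    using Cons by (auto simp: distinct_adj_Cons)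
  have eq: "subword_occurrences \<tau> (expand (x # v) (m # ms)) =
      of_bool (k \<ge> 1 \<and> v \<noteq> [] \<and> R x (hd v)) + subword_occurrences \<tau> (expand v ms)"
    using level_then_step_prepend_block[of \<tau> R x "expand v ms" k, OF \<tau> R w] Cons
    by (auto simp: k hd_expand expand_eq_Nil_iff)
  show ?case unfolding eq IH
    by (cases v) (auto simp: k card_less_Suc_shift)
qed

lemma occurrences_step_then_level:
  assumes \<tau>: "length \<tau> = 3" "\<And>a b c. order_isomorphic [a, b, c] \<tau> \<longleftrightarrow> R a b \<and> b = c"
    and R: "\<And>x. \<not> R x x"
    and "length ms = length v" "0 \<notin> set ms" "distinct_adj v"
  shows "subword_occurrences \<tau> (expand v ms) =
    card {j. Suc j < length v \<and> R (v ! j) (v ! Suc j) \<and> 2 \<le> ms ! Suc j}"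
  using assms(4-)
proof (induction ms v rule: list_induct2)
  case Nil
  show ?case using \<tau>(1) by (simp add: subword_occurrences_short)
next
  case (Cons m ms x v)
  obtain k where k: "m = Suc k" using Cons.prems by (cases m) auto
  have IH: "subword_occurrences \<tau> (expand v ms) =
      card {j. Suc j < length v \<and> R (v ! j) (v ! Suc j) \<and> 2 \<le> ms ! Suc j}"
    using Cons by (auto simp: distinct_adj_Cons)
  have eq: "subword_occurrences \<tau> (expand (x # v) (m # ms)) =
      of_bool (2 \<le> length (expand v ms) \<and> R x (hd (expand v ms)) \<and>
        expand v ms ! 0 = expand v ms ! 1) + subword_occurrences \<tau> (expand v ms)"
    using step_then_level_prepend_block[of \<tau> R x k "expand v ms", OF \<tau> R] by (simp add: k)
  show ?case
  proof (cases v)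
    case Nil
    then show ?thesis using eq Cons \<tau>(1) by (simp add: subword_occurrences_short)
  next
    case v: (Cons y v')
    obtain l ls where ms: "ms = l # ls" using Cons.hyps v by (cases ms) auto
    have l: "l \<noteq> 0" "0 \<notin> set ls" "length ls = length v'" "distinct_adj (y # v')"
      using Cons v ms by (auto simp: distinct_adj_Cons)
    have "2 \<le> length (expand v ms) \<and> expand v ms ! 0 = expand v ms ! 1 \<longleftrightarrow> 2 \<le> l"
    proof (cases "l = 1")
      case True
      have "u = [] \<or> hd u \<noteq> y" if "u = expand v' ls" for u
        using that l by (auto simp: hd_expand expand_eq_Nil_iff distinct_adj_Cons)
      then show ?thesis using True v ms
        by (cases "expand v' ls") auto
    next
      case False
      then obtain l' where "l = Suc (Suc l')" using l by (metis One_nat_def not0_implies_Suc)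
      then show ?thesis using v ms by auto
    qed
    moreover have "hd (expand v ms) = y" using Cons v by (auto simp: hd_expand)
    ultimately show ?thesis
      unfolding eq IH by (auto simp: v ms card_less_Suc_shift)
  qed
qed

section \<open>Permuting block lengths\<close>

lemma ex_permutes_image:
  assumes "finite S" "A \<subseteq> S" "B \<subseteq> S" "card A = card B"
  obtains \<sigma> where "\<sigma> permutes S" "\<sigma> ` A = B"
proof -
  have fin: "finite A" "finite B" using assms finite_subset by blast+
  obtain f where f: "bij_betw f A B"
    using finite_same_card_bij[OF fin assms(4)] by blast
  have "card (S - A) = card (S - B)"
    using assms fin by (simp add: card_Diff_subset)
  then obtain g where g: "bij_betw g (S - A) (S - B)"
    using finite_same_card_bij[of "S - A" "S - B"] assms(1) by blast
  define \<sigma> where "\<sigma> x = (if x \<in> A then f x else if x \<in> S then g x else x)" for x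
  have A: "bij_betw \<sigma> A B"
    using f by (rule bij_betw_cong[THEN iffD1, rotated]) (simp add: \<sigma>_def)
  have "bij_betw \<sigma> (S - A) (S - B)"
    using g by (rule bij_betw_cong[THEN iffD1, rotated]) (simp add: \<sigma>_def)
  with A have "bij_betw \<sigma> (A \<union> (S - A)) (B \<union> (S - B))"
    by (rule bij_betw_combine) blast
  then have "bij_betw \<sigma> S S"
    using assms by (simp add: Un_absorb1)
  then have "\<sigma> permutes S"
    by (rule bij_imp_permutes) (use assms in \<open>auto simp: \<sigma>_def\<close>)
  with A that show thesis by (auto simp: bij_betw_def)
qed

lemma bij_betw_permute_list:
  assumes \<sigma>: "\<sigma> permutes {..<k}"
    and inv: "\<And>xs ys. mset xs = mset ys \<Longrightarrow> P xs \<longleftrightarrow> P ys"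
    and AB: "\<And>xs. length xs = k \<Longrightarrow> A (permute_list \<sigma> xs) \<longleftrightarrow> B xs"
  shows "bij_betw (permute_list \<sigma>)
    {xs. length xs = k \<and> P xs \<and> B xs} {xs. length xs = k \<and> P xs \<and> A xs}"
proof (rule bij_betw_byWitness[where f' = "permute_list (inv \<sigma>)"])
  have \<sigma>': "inv \<sigma> permutes {..<k}" using \<sigma> by (rule permutes_inv)
  have 1: "permute_list (inv \<sigma>) (permute_list \<sigma> xs) = xs" if "length xs = k" for xs :: "'a list"
    using permute_list_compose[of "inv \<sigma>" xs \<sigma>] \<sigma>' \<sigma> that
    by (simp add: permutes_inv_o)
  have 2: "permute_list \<sigma> (permute_list (inv \<sigma>) xs) = xs" if "length xs = k" for xs :: "'a list"
    using permute_list_compose[of \<sigma> xs "inv \<sigma>"] \<sigma>' \<sigma> that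
    by (simp add: permutes_inv_o)
  show "\<forall>a\<in>{xs. length xs = k \<and> P xs \<and> B xs}. permute_list (inv \<sigma>) (permute_list \<sigma> a) = a"
    using 1 by simp
  show "\<forall>a\<in>{xs. length xs = k \<and> P xs \<and> A xs}. permute_list \<sigma> (permute_list (inv \<sigma>) a) = a"
    using 2 by simp
  have P1: "P (permute_list \<sigma> xs) \<longleftrightarrow> P xs" if "length xs = k" for xs
    by (rule inv) (use \<sigma> that in simp)
  have P2: "P (permute_list (inv \<sigma>) xs) \<longleftrightarrow> P xs" if "length xs = k" for xs
    by (rule inv) (use \<sigma>' that in simp)
  show "permute_list \<sigma> ` {xs. length xs = k \<and> P xs \<and> B xs} \<subseteq> {xs. length xs = k \<and> P xs \<and> A xs}"
    using P1 AB by auto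
  show "permute_list (inv \<sigma>) ` {xs. length xs = k \<and> P xs \<and> A xs}
      \<subseteq> {xs. length xs = k \<and> P xs \<and> B xs}"
    using P2 AB[of "permute_list (inv \<sigma>) _"] 2 by auto
qed

text \<open>
  The combinatorial core. For \<open>I\<close> the set of positions of the steps, the statistics count the
  indices \<open>j \<in> I\<close> and \<open>j \<in> Suc ` I\<close> with \<open>2 \<le> ms ! j\<close>, and any permutation of the indices that maps \<open>I\<close>
  onto \<open>Suc ` I\<close> turns one count into the other.
\<close>

lemma card_block_lengths_shift:
  fixes n :: nat
  assumes I: "\<And>j. j \<in> I \<Longrightarrow> Suc j < k"
  shows "card {ms. length ms = k \<and> 0 \<notin> set ms \<and> sum_list ms = n \<and> card {j \<in> I. 2 \<le> ms ! j} = q} =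
    card {ms. length ms = k \<and> 0 \<notin> set ms \<and> sum_list ms = n \<and> card {j \<in> I. 2 \<le> ms ! Suc j} = q}"
proof -
  have "card I = card (Suc ` I)" by (simp add: card_image)
  moreover have "I \<subseteq> {..<k}" "Suc ` I \<subseteq> {..<k}" using I by (auto dest: Suc_lessD)
  ultimately obtain \<sigma> where \<sigma>: "\<sigma> permutes {..<k}" "\<sigma> ` I = Suc ` I"
    using ex_permutes_image[of "{..<k}" I "Suc ` I"] by blast
  let ?P = "\<lambda>ms :: nat list. 0 \<notin> set ms \<and> sum_list ms = n"
  have "card {j \<in> I. 2 \<le> permute_list \<sigma> ms ! j} = card {j \<in> I. 2 \<le> ms ! Suc j}"
    if "length ms = k" for ms :: "nat list"
  proof -
    have "{j \<in> I. 2 \<le> permute_list \<sigma> ms ! j} = {j \<in> I. 2 \<le> ms ! \<sigma> j}"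
      using \<sigma> that I by (auto simp: permute_list_nth Suc_lessD)
    moreover have "card {j \<in> I. 2 \<le> ms ! \<sigma> j} = card (\<sigma> ` {j \<in> I. 2 \<le> ms ! \<sigma> j})"
      using \<sigma> by (simp add: card_image permutes_inj_on)
    moreover have "\<sigma> ` {j \<in> I. 2 \<le> ms ! \<sigma> j} = {j \<in> \<sigma> ` I. 2 \<le> ms ! j}" by auto
    moreover have "{j \<in> \<sigma> ` I. 2 \<le> ms ! j} = Suc ` {j \<in> I. 2 \<le> ms ! Suc j}" by (auto simp: \<sigma>)
    ultimately show ?thesis by (simp add: card_image)
  qed
  then have "bij_betw (permute_list \<sigma>)
      {ms. length ms = k \<and> ?P ms \<and> card {j \<in> I. 2 \<le> ms ! Suc j} = q}
      {ms. length ms = k \<and> ?P ms \<and> card {j \<in> I. 2 \<le> ms ! j} = q}"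
    by (intro bij_betw_permute_list \<sigma>) (auto dest: mset_eq_setD simp flip: sum_mset_sum_list)
  from bij_betw_same_card[OF this] show ?thesis by simp
qed

section \<open>Equidistribution on sets of words determined by skeletons\<close>

lemma card_fixed_skeleton:
  assumes "length \<sigma> = 3" "\<And>a b c. order_isomorphic [a, b, c] \<sigma> \<longleftrightarrow> a = b \<and> R b c"
    and "length \<tau> = 3" "\<And>a b c. order_isomorphic [a, b, c] \<tau> \<longleftrightarrow> R a b \<and> b = c"
    and R: "\<And>x. \<not> R x x" and v: "distinct_adj v"
  shows "card {w. remdups_adj w = v \<and> length w = n \<and> subword_occurrences \<sigma> w = q} =
    card {w. remdups_adj w = v \<and> length w = n \<and> subword_occurrences \<tau> w = q}"
proof -
  let ?I = "{j. Suc j < length v \<and> R (v ! j) (v ! Suc j)}"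
  let ?M = "\<lambda>Q. {ms. length ms = length v \<and> 0 \<notin> set ms \<and> sum_list ms = n \<and> Q ms}"
  have "?M (\<lambda>ms. subword_occurrences \<sigma> (expand v ms) = q) =
      ?M (\<lambda>ms. card {j \<in> ?I. 2 \<le> ms ! j} = q)"
    by (rule Collect_cong)
      (auto simp: occurrences_level_then_step[of \<sigma> R, OF assms(1,2) R _ _ v])
  moreover have "?M (\<lambda>ms. subword_occurrences \<tau> (expand v ms) = q) =
      ?M (\<lambda>ms. card {j \<in> ?I. 2 \<le> ms ! Suc j} = q)"
    by (rule Collect_cong)
      (auto simp: occurrences_step_then_level[of \<tau> R, OF assms(3,4) R _ _ v])
  moreover have "card (?M (\<lambda>ms. card {j \<in> ?I. 2 \<le> ms ! j} = q)) =
      card (?M (\<lambda>ms. card {j \<in> ?I. 2 \<le> ms ! Suc j} = q))"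
    by (rule card_block_lengths_shift) simp
  ultimately show ?thesis
    using bij_betw_same_card[OF bij_betw_expand[OF v, of n "\<lambda>w. subword_occurrences \<sigma> w = q"]]
      bij_betw_same_card[OF bij_betw_expand[OF v, of n "\<lambda>w. subword_occurrences \<tau> w = q"]]
    by simp
qed

lemma card_eq_by_skeleton:
  assumes fin: "finite F" and len: "\<And>w. w \<in> F \<Longrightarrow> length w = n"
    and closed: "\<And>w w'. w \<in> F \<Longrightarrow> remdups_adj w' = remdups_adj w \<Longrightarrow> length w' = n \<Longrightarrow> w' \<in> F"
    and eq: "\<And>v. distinct_adj v \<Longrightarrow> card {w. remdups_adj w = v \<and> length w = n \<and> P w} =
      card {w. remdups_adj w = v \<and> length w = n \<and> Q w}"
  shows "card {w \<in> F. P w} = card {w \<in> F. Q w}"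
proof -
  let ?V = "remdups_adj ` F"
  have split: "card {w \<in> F. S w} =
      (\<Sum>v\<in>?V. card {w. remdups_adj w = v \<and> length w = n \<and> S w})" for S
  proof -
    have "card {w \<in> F. S w} = (\<Sum>v\<in>?V. card {w \<in> {w \<in> F. S w}. remdups_adj w = v})"
      using sum.group[of "{w \<in> F. S w}" ?V remdups_adj "\<lambda>_. 1::nat"] fin by fastforce
    also have "\<dots> = (\<Sum>v\<in>?V. card {w. remdups_adj w = v \<and> length w = n \<and> S w})"
    proof (rule sum.cong[OF refl])
      fix v assume "v \<in> ?V"
      then have "{w \<in> {w \<in> F. S w}. remdups_adj w = v} =
          {w. remdups_adj w = v \<and> length w = n \<and> S w}"
        using len closed by auto
      then show "card {w \<in> {w \<in> F. S w}. remdups_adj w = v} =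
          card {w. remdups_adj w = v \<and> length w = n \<and> S w}" by simp
    qed
    finally show ?thesis .
  qed
  show ?thesis unfolding split by (rule sum.cong[OF refl]) (auto intro: eq)
qed

section \<open>Flattened Catalan words are determined by skeletons\<close>

lemma catalan_word_successively:
  "catalan_word w \<longleftrightarrow>
    w \<noteq> [] \<and> hd w = 1 \<and> (\<forall>x\<in>set w. 1 \<le> x) \<and> successively (\<lambda>x y. y \<le> x + 1) w"
proof -
  have "(\<forall>x\<in>set w. 1 \<le> x) \<longleftrightarrow> (\<forall>i. Suc i < length w \<longrightarrow> 1 \<le> w ! Suc i)"
    if "w \<noteq> []" "hd w = 1"
    using that by (cases w) (auto simp: all_set_conv_all_nth)
  then show ?thesis
    by (auto simp: catalan_word_def successively_conv_nth hd_conv_nth)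
qed

text \<open>Equal neighbours satisfy the Catalan step condition, so contracting them loses nothing.\<close>

lemma catalan_word_remdups_adj: "catalan_word (remdups_adj w) \<longleftrightarrow> catalan_word w"
  by (simp add: catalan_word_successively successively_remdups_adj_iff)

lemma nondec_factor_iff:
  "nondec_factor w i j \<longleftrightarrow>
    i < j \<and> j \<le> length w \<and> (\<forall>k. i \<le> k \<and> Suc k < j \<longrightarrow> w ! k \<le> w ! Suc k)"
proof -
  have "sorted (factor w i j) \<longleftrightarrow> (\<forall>k. i \<le> k \<and> Suc k < j \<longrightarrow> w ! k \<le> w ! Suc k)"
    if "i < j" "j \<le> length w"
  proof -
    have "sorted (factor w i j) \<longleftrightarrow> (\<forall>l. Suc l < j - i \<longrightarrow> w ! (i + l) \<le> w ! Suc (i + l))"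
      using that by (auto simp: sorted_iff_nth_Suc factor_def)
    also have "\<dots> \<longleftrightarrow> (\<forall>k. i \<le> k \<and> Suc k < j \<longrightarrow> w ! k \<le> w ! Suc k)"
    proof safe
      fix k assume "\<forall>l. Suc l < j - i \<longrightarrow> w ! (i + l) \<le> w ! Suc (i + l)" "i \<le> k" "Suc k < j"
      from this(1)[rule_format, of "k - i"] this(2,3) show "w ! k \<le> w ! Suc k" by simp
    qed auto
    finally show ?thesis .
  qed
  then show ?thesis by (auto simp: nondec_factor_def)
qed

lemma run_starts_descents:
  "run_starts w = {i. i < length w \<and> (i = 0 \<or> w ! i < w ! (i - 1))}"
proof (intro set_eqI iffI)
  fix i assume "i \<in> run_starts w"
  then obtain j where ij: "nondec_factor w i j"
    and max: "\<And>i' j'. i' \<le> i \<Longrightarrow> j \<le> j' \<Longrightarrow> nondec_factor w i' j' \<Longrightarrow> i' = i \<and> j' = j"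
    unfolding run_starts_def increasing_run_def by blast
  have "w ! i < w ! (i - 1)" if "i > 0"
  proof (rule ccontr)
    assume "\<not> w ! i < w ! (i - 1)"
    \<comment> \<open>Otherwise the run could be extended to the left.\<close>
    have "w ! k \<le> w ! Suc k" if "i - 1 \<le> k" "Suc k < j" for k
    proof (cases "k = i - 1")
      case True
      with \<open>\<not> w ! i < w ! (i - 1)\<close> \<open>i > 0\<close> show ?thesis by simp
    next
      case False
      with that ij show ?thesis by (auto simp: nondec_factor_iff)
    qed
    with ij have "nondec_factor w (i - 1) j" by (auto simp: nondec_factor_iff)
    with max[of "i - 1" j] that show False by simp
  qed
  with ij show "i \<in> {i. i < length w \<and> (i = 0 \<or> w ! i < w ! (i - 1))}"
    by (auto simp: nondec_factor_iff)
next
  fix i assume i: "i \<in> {i. i < length w \<and> (i = 0 \<or> w ! i < w ! (i - 1))}"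
  then have ex: "nondec_factor w i (Suc i)" by (auto simp: nondec_factor_iff)
  \<comment> \<open>The run starting at \<open>i\<close> ends at the largest possible end position.\<close>
  obtain j where j: "nondec_factor w i j"
    and greatest: "\<And>j'. nondec_factor w i j' \<Longrightarrow> j' \<le> j"
    using ex_has_greatest_nat[of "nondec_factor w i" "Suc i" id "Suc (length w)"] ex
    by (auto simp: nondec_factor_iff less_Suc_eq_le)
  have "i' = i \<and> j' = j" if "i' \<le> i" "j \<le> j'" "nondec_factor w i' j'" for i' j'
  proof -
    have "i' = i"
    proof (rule ccontr)
      assume "i' \<noteq> i"
      with that j have "w ! (i - 1) \<le> w ! Suc (i - 1)"
        unfolding nondec_factor_iff
        by (metis Suc_diff_1 gr_zeroI le_neq_implies_less less_Suc_eq_le order_less_le_trans)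
      with i \<open>i' \<noteq> i\<close> \<open>i' \<le> i\<close> show False by auto
    qed
    with that greatest show ?thesis by (auto intro: antisym)
  qed
  with j show "i \<in> run_starts w" unfolding run_starts_def increasing_run_def by blast
qed

text \<open>
  The map \<open>f\<close> sends each position of the word to the index of its block. Runs start only at the
  first position of a block, and \<open>f\<close> carries the run starts of the word monotonically, and with the
  same letters, onto those of the skeleton.
\<close>

lemma flattened_remdups_adj: "flattened (remdups_adj w) \<longleftrightarrow> flattened w"
proof -
  define v where "v = remdups_adj w"
  obtain f :: "nat \<Rightarrow> nat" where f: "mono f" "f ` {0..<length w} = {0..<length v}"
    "\<And>i. i < length w \<Longrightarrow> w ! i = v ! f i"
    "\<And>i. Suc i < length w \<Longrightarrow> w ! i = w ! Suc i \<longleftrightarrow> f i = f (Suc i)"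
    using remdups_adj_altdef[of w v] v_def by auto
  have less: "f i < length v" if "i < length w" for i
    using f(2) that by (metis atLeastLessThan_iff imageI zero_le)
  have onto: "\<exists>i<length w. f i = p" if "p < length v" for p
    using f(2) that by (metis atLeastLessThan_iff imageE zero_le)
  \<comment> \<open>A monotone surjection onto an initial segment cannot skip a value.\<close>
  have step: "f (Suc i) \<le> Suc (f i)" if "Suc i < length w" for i
  proof (rule ccontr)
    assume "\<not> f (Suc i) \<le> Suc (f i)"
    moreover from this less[OF that] obtain l where "f l = Suc (f i)"
      using onto[of "Suc (f i)"] by auto
    ultimately show False
      using monoD[OF f(1), of l i] monoD[OF f(1), of "Suc i" l] by (cases "l \<le> i") auto
  qed
  have zero: "f 0 = 0" if "w \<noteq> []"
  proof -
    have "0 < length v" using that by (simp add: v_def)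
    then obtain i where "f i = 0" using onto by blast
    then show ?thesis using monoD[OF f(1), of 0 i] by simp
  qed
  have to: "f i \<in> run_starts v" if "i \<in> run_starts w" for i
  proof (cases i)
    case 0
    then show ?thesis using that zero less[of i] by (auto simp: run_starts_descents)
  next
    case (Suc l)
    with that have l: "Suc l < length w" "w ! Suc l < w ! l" by (auto simp: run_starts_descents)
    then have "f l \<noteq> f (Suc l)" using f(4)[of l] by auto
    moreover have "f l \<le> f (Suc l)" using f(1) by (simp add: monoD)
    ultimately have "f (Suc l) = Suc (f l)" using step[of l] l by simp
    then show ?thesis
      using Suc l f(3)[of l] f(3)[of "Suc l"] less[of "Suc l"] by (auto simp: run_starts_descents)
  qed
  have from_run: "\<exists>i\<in>run_starts w. f i = p" if p: "p \<in> run_starts v" for p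
  proof -
    define i where "i = (LEAST i. i < length w \<and> f i = p)"
    have i: "i < length w" "f i = p"
      using LeastI_ex[OF onto[of p]] p by (auto simp: i_def run_starts_descents)
    have least: "f l \<noteq> p" if "l < i" for l
      using not_less_Least[OF that[unfolded i_def]] i that by auto
    have "i \<in> run_starts w"
    proof (cases i)
      case 0
      then show ?thesis using i by (simp add: run_starts_descents)
    next
      case (Suc l)
      have "f l \<noteq> f (Suc l)" using least[of l] i Suc by auto
      moreover have "f l \<le> f (Suc l)" using f(1) by (simp add: monoD)
      ultimately have "f (Suc l) = Suc (f l)" using step[of l] i Suc by simp
      then show ?thesis
        using i Suc p f(3)[of l] f(3)[of "Suc l"]
        by (auto simp: run_starts_descents dest: sym[of _ "f (Suc l)"])
    qed
    with i show ?thesis by blast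
  qed
  have same: "w ! i = v ! f i" if "i \<in> run_starts w" for i
    using that f(3) by (simp add: run_starts_descents)
  have "flattened v \<longleftrightarrow> flattened w"
  proof
    assume v: "flattened v"
    show "flattened w" unfolding flattened_def
    proof (rule mono_onI)
      fix i j assume ij: "i \<in> run_starts w" "j \<in> run_starts w" "i \<le> j"
      then have "v ! f i \<le> v ! f j"
        using v f(1) to unfolding flattened_def by (auto simp: mono_on_def monoD)
      then show "w ! i \<le> w ! j" using same ij by simp
    qed
  next
    assume w: "flattened w"
    show "flattened v" unfolding flattened_def
    proof (rule mono_onI)
      fix p q assume pq: "p \<in> run_starts v" "q \<in> run_starts v" "p \<le> q"
      then obtain i j where ij: "i \<in> run_starts w" "j \<in> run_starts w" "f i = p" "f j = q"
        using from_run by blast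
      show "v ! p \<le> v ! q"
      proof (cases "i \<le> j")
        case True
        then show ?thesis using w ij same unfolding flattened_def by (auto simp: mono_on_def)
      next
        case False
        \<comment> \<open>Monotonicity of \<open>f\<close> then forces both runs to start in the same block.\<close>
        then have "p = q" using monoD[OF f(1), of j i] ij pq by simp
        then show ?thesis by simp
      qed
    qed
  qed
  then show ?thesis by (simp add: v_def)
qed

text \<open>
  With \<open>R\<close> the relation \<open><\<close> this covers 112 and 122, and with \<open>>\<close> it covers 221 and 211.
\<close>

lemma equidistributed_if_level_moves_across_step:
  assumes "length \<sigma> = 3" "\<And>a b c. order_isomorphic [a, b, c] \<sigma> \<longleftrightarrow> a = b \<and> R b c"
    and "length \<tau> = 3" "\<And>a b c. order_isomorphic [a, b, c] \<tau> \<longleftrightarrow> R a b \<and> b = c"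
    and "\<And>x. \<not> R x x"
  shows "equidistributed n \<sigma> \<tau>"
  unfolding equidistributed_def
proof (intro allI card_eq_by_skeleton[OF finite_flattened_catalan_words])
  fix w w' assume "w \<in> flattened_catalan_words n" "remdups_adj w' = remdups_adj w" "length w' = n"
  then show "w' \<in> flattened_catalan_words n"
    unfolding flattened_catalan_words_def
    by (metis (mono_tags, lifting) catalan_word_remdups_adj flattened_remdups_adj mem_Collect_eq)
qed (auto simp: flattened_catalan_words_def intro: card_fixed_skeleton[OF assms])

theorem corollary3p1:
  fixes n :: nat
  assumes "n \<ge> 1"
  shows "equidistributed n [1, 1, 2] [1, 2, 2] \<and> equidistributed n [2, 2, 1] [2, 1, 1]"
proof
  show "equidistributed n [1, 1, 2] [1, 2, 2]"
    by (rule equidistributed_if_level_moves_across_step[where R = "(<)"])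
      (auto simp: order_isomorphic_length3)
  show "equidistributed n [2, 2, 1] [2, 1, 1]"
    by (rule equidistributed_if_level_moves_across_step[where R = "(>)"])
      (auto simp: order_isomorphic_length3)
qed

end
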